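(* Let $x>1$ be real and let $R_*=\frac{3-\sqrt5}{2}$. Then the series $$\frac{1}{[x]_q}=\sum_{N\ge0}\frac{q^{C_N}}{a_N(q)a_{N+1}(q)}$$ converges absolutely on the real interval $(-R_*,1)$ and uniformly on its compact subsets to a continuous positive function of $q$.
   Context: For an integer $n\ge 0$ put $[n]_q=\frac{1-q^n}{1-q}$. Every real $x\ge1$ has a unique expansion $x=[[c_1,c_2,\ldots]]:=c_1-\frac{1}{c_2-\frac{1}{c_3-\cdots}}$ with integers $c_j\ge2$ (rational $x$ correspond to sequences eventually equal to $2$). The $q$-real number $[x]_q\in\mathbb Z[[q]]$ is the $q$-adic limit as $N\to\infty$ of $[c_1]_q-\frac{q^{c_1-1}}{[c_2]_q-\cdots\frac{q^{c_{N-1}-1}}{[c_N]_q}}$. Define polynomials $a_0(q)=1$, $a_1(q)=[c_1]_q$, $a_N(q)=[c_N]_q\,a_{N-1}(q)-q^{c_{N-1}-1}a_{N-2}(q)$ for $N\ge2$, and $C_N:=\sum_{j=1}^N(c_j-1)$ (so $C_0=0$). The displayed equality with $1/[x]_q$ holds $q$-adically. *)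

theory Defs
  imports
    "HOL-Analysis.Analysis"
    "HOL-Computational_Algebra.Polynomial_FPS"
begin

section \<open>Negative continued fractions\<close>

text \<open>
  Sequences are indexed from 0: \<open>c j\<close> stands for $c_{j+1}$.
  \<open>ncf_conv c n\<close> is the finite continued fraction with the \<open>n + 1\<close> entries
  \<open>c 0, \<dots>, c n\<close>.
\<close>

fun ncf_conv :: "(nat \<Rightarrow> nat) \<Rightarrow> nat \<Rightarrow> real" where
  "ncf_conv c 0 = real (c 0)"
| "ncf_conv c (Suc n) = real (c 0) - 1 / ncf_conv (\<lambda>j. c (Suc j)) n"

definition is_ncf_expansion :: "real \<Rightarrow> (nat \<Rightarrow> nat) \<Rightarrow> bool" where
  "is_ncf_expansion x c \<longleftrightarrow> (\<forall>j. c j \<ge> 2) \<and> ncf_conv c \<longlonglongrightarrow> x"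

text \<open>Well defined for \<open>x \<ge> 1\<close>; see \<open>ex1_ncf_expansion\<close> below.\<close>

definition ncf :: "real \<Rightarrow> nat \<Rightarrow> nat" where
  "ncf x = (THE c. is_ncf_expansion x c)"


section \<open>q-analogues\<close>

definition q_int :: "nat \<Rightarrow> int poly" where
  "q_int n = (\<Sum>i<n. monom 1 i)"

lemma q_int_geometric: "(1 - monom 1 1) * q_int n = 1 - monom 1 n"
proof (induction n)
  case (Suc n)
  have "q_int (Suc n) = q_int n + monom 1 n" by (simp add: q_int_def add.commute)
  then show ?case using Suc by (simp add: distrib_left left_diff_distrib mult_monom)
qed (simp add: q_int_def)

text \<open>
  The inverse in \<open>\<int>[[q]]\<close> of a power series with constant coefficient 1
  (the class-based \<open>inverse\<close> needs coefficients in a division ring).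
\<close>

definition fps_recip :: "int fps \<Rightarrow> int fps" where
  "fps_recip f = fps_right_inverse f 1"

lemma fps_recip: "fps_nth f 0 = 1 \<Longrightarrow> f * fps_recip f = 1"
  unfolding fps_recip_def by (rule fps_right_inverse) simp

fun q_conv :: "(nat \<Rightarrow> nat) \<Rightarrow> nat \<Rightarrow> int fps" where
  "q_conv c 0 = fps_of_poly (q_int (c 0))"
| "q_conv c (Suc n) =
     fps_of_poly (q_int (c 0)) - fps_X ^ (c 0 - 1) * fps_recip (q_conv (\<lambda>j. c (Suc j)) n)"

text \<open>The topology on \<open>int fps\<close> is the q-adic one.\<close>

definition q_real :: "real \<Rightarrow> int fps" where
  "q_real x = lim (q_conv (ncf x))"

fun a_poly :: "(nat \<Rightarrow> nat) \<Rightarrow> nat \<Rightarrow> int poly" where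
  "a_poly c 0 = 1"
| "a_poly c (Suc 0) = q_int (c 0)"
| "a_poly c (Suc (Suc N)) =
     q_int (c (Suc N)) * a_poly c (Suc N) - monom 1 (c N - 1) * a_poly c N"

definition C_exp :: "(nat \<Rightarrow> nat) \<Rightarrow> nat \<Rightarrow> nat" where
  "C_exp c N = (\<Sum>j<N. (c j - 1))"

definition a_eval :: "(nat \<Rightarrow> nat) \<Rightarrow> nat \<Rightarrow> real \<Rightarrow> real" where
  "a_eval c N q = poly (map_poly real_of_int (a_poly c N)) q"

definition fps_term :: "(nat \<Rightarrow> nat) \<Rightarrow> nat \<Rightarrow> int fps" where
  "fps_term c N = fps_X ^ C_exp c N * fps_recip (fps_of_poly (a_poly c N * a_poly c (Suc N)))"

definition real_term :: "(nat \<Rightarrow> nat) \<Rightarrow> nat \<Rightarrow> real \<Rightarrow> real" where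
  "real_term c N q = q ^ C_exp c N / (a_eval c N q * a_eval c (Suc N) q)"

definition R_star :: real where
  "R_star = (3 - sqrt 5) / 2"


section \<open>Well-definedness\<close>

subsection \<open>Existence and uniqueness of the expansion\<close>

lemma ncf_conv_ge:
  assumes "\<And>j. c j \<ge> 2"
  shows "ncf_conv c n > 1" "ncf_conv c n \<ge> real (c 0) - 1" "ncf_conv c n \<le> real (c 0)"
proof -
  have gt: "ncf_conv c n > 1" if "\<And>j. c j \<ge> 2" for c n
    using that
  proof (induction n arbitrary: c)
    case 0
    have "c 0 \<ge> 2" by (rule 0)
    then show ?case by simp
  next
    case (Suc n)
    have "1 < ncf_conv (\<lambda>j. c (Suc j)) n" by (rule Suc.IH) (rule Suc.prems)
    then have "1 / ncf_conv (\<lambda>j. c (Suc j)) n < 1" by simp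
    moreover have "real (c 0) \<ge> 2" using Suc.prems[of 0] by simp
    ultimately show ?case by simp
  qed
  show "ncf_conv c n > 1" by (rule gt) (rule assms)
  show "ncf_conv c n \<ge> real (c 0) - 1" "ncf_conv c n \<le> real (c 0)"
  proof -
    have "ncf_conv c n \<ge> real (c 0) - 1 \<and> ncf_conv c n \<le> real (c 0)"
    proof (cases n)
      case (Suc m)
      have "1 < ncf_conv (\<lambda>j. c (Suc j)) m" by (rule gt) (rule assms)
      then show ?thesis using Suc by (simp add: field_simps)
    qed simp
    then show "ncf_conv c n \<ge> real (c 0) - 1" "ncf_conv c n \<le> real (c 0)" by auto
  qed
qed

lemma ncf_conv_antimono:
  assumes "\<And>j. c j \<ge> 2"
  shows "ncf_conv c (Suc n) \<le> ncf_conv c n"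
  using assms
proof (induction n arbitrary: c)
  case 0
  have "c 1 \<ge> 2" by (rule 0)
  then show ?case by simp
next
  case (Suc n)
  let ?d = "\<lambda>j. c (Suc j)"
  have d: "\<And>j. ?d j \<ge> 2" using Suc.prems by blast
  have "ncf_conv ?d (Suc n) \<le> ncf_conv ?d n" by (rule Suc.IH) (rule d)
  moreover have "ncf_conv ?d (Suc n) > 1" using ncf_conv_ge(1)[of ?d] d by blast
  ultimately have "1 / ncf_conv ?d n \<le> 1 / ncf_conv ?d (Suc n)"
    by (intro divide_left_mono) auto
  then show ?case by (simp only: ncf_conv.simps)
qed

lemma ncf_conv_convergent:
  assumes "\<And>j. c j \<ge> 2"
  obtains y where "ncf_conv c \<longlonglongrightarrow> y" "y \<ge> 1"
proof -
  have dec: "decseq (ncf_conv c)"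
    by (rule decseq_SucI) (rule ncf_conv_antimono[OF assms])
  have "\<And>n. 1 \<le> ncf_conv c n"
    using ncf_conv_ge(1)[of c] assms less_imp_le by blast
  then obtain y where "ncf_conv c \<longlonglongrightarrow> y" "\<And>i. y \<le> ncf_conv c i"
    using decseq_convergent[OF dec] by blast
  moreover have "1 \<le> y"
    using \<open>ncf_conv c \<longlonglongrightarrow> y\<close> \<open>\<And>n. 1 \<le> ncf_conv c n\<close> by (intro LIMSEQ_le_const) auto
  ultimately show ?thesis using that by blast
qed

text \<open>A limit satisfies the expected recursion, and hence determines its first entry.\<close>

lemma ncf_expansion_step:
  assumes "is_ncf_expansion x c"
  obtains y where "is_ncf_expansion y (\<lambda>j. c (Suc j))" "y \<ge> 1" "x = real (c 0) - 1 / y"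
proof -
  let ?d = "\<lambda>j. c (Suc j)"
  have c: "\<And>j. c j \<ge> 2" and lim: "ncf_conv c \<longlonglongrightarrow> x"
    using assms by (auto simp: is_ncf_expansion_def)
  have d: "\<And>j. ?d j \<ge> 2" using c by blast
  obtain y where y: "ncf_conv ?d \<longlonglongrightarrow> y" "y \<ge> 1"
    using ncf_conv_convergent[of ?d] d by blast
  have "(\<lambda>n. real (c 0) - 1 / ncf_conv ?d n) \<longlonglongrightarrow> real (c 0) - 1 / y"
    using y by (intro tendsto_intros) auto
  moreover have "(\<lambda>n. ncf_conv c (Suc n)) \<longlonglongrightarrow> x" using lim by (rule LIMSEQ_Suc)
  ultimately have "x = real (c 0) - 1 / y" by (auto intro: LIMSEQ_unique)
  then show ?thesis using that y d by (simp add: is_ncf_expansion_def)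
qed

lemma ncf_expansion_ge_1:
  assumes "is_ncf_expansion x c"
  shows "x \<ge> 1"
proof -
  have "\<And>j. c j \<ge> 2" "ncf_conv c \<longlonglongrightarrow> x" using assms by (auto simp: is_ncf_expansion_def)
  then show ?thesis using ncf_conv_convergent[of c] LIMSEQ_unique[of "ncf_conv c" x] by metis
qed

lemma ncf_expansion_first:
  assumes "is_ncf_expansion x c"
  shows "int (c 0) = \<lfloor>x\<rfloor> + 1"
proof -
  obtain y where "y \<ge> 1" "x = real (c 0) - 1 / y" using ncf_expansion_step[OF assms] by blast
  moreover have "0 < 1 / y" "1 / y \<le> 1" using \<open>y \<ge> 1\<close> by auto
  ultimately show ?thesis by linarith
qed

lemma ncf_expansion_unique:
  assumes "is_ncf_expansion x c" "is_ncf_expansion x d"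
  shows "c = d"
proof -
  have "c j = d j" for j
    using assms
  proof (induction j arbitrary: x c d)
    case 0
    then show ?case using ncf_expansion_first[of x c] ncf_expansion_first[of x d] by simp
  next
    case (Suc j)
    have "c 0 = d 0"
      using ncf_expansion_first[OF Suc.prems(1)] ncf_expansion_first[OF Suc.prems(2)] by simp
    obtain y where y: "is_ncf_expansion y (\<lambda>j. c (Suc j))" "x = real (c 0) - 1 / y"
      using ncf_expansion_step[OF Suc.prems(1)] by blast
    obtain z where z: "is_ncf_expansion z (\<lambda>j. d (Suc j))" "x = real (d 0) - 1 / z"
      using ncf_expansion_step[OF Suc.prems(2)] by blast
    have "1 / y = 1 / z" using y z \<open>c 0 = d 0\<close> by simp
    then have "y = z" by simp
    then show ?case using Suc.IH[OF y(1)] z(1) by simp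
  qed
  then show ?thesis by blast
qed

primrec ncf_rem :: "real \<Rightarrow> nat \<Rightarrow> real" where
  "ncf_rem x 0 = x"
| "ncf_rem x (Suc n) = 1 / (of_int \<lfloor>ncf_rem x n\<rfloor> + 1 - ncf_rem x n)"

lemma ncf_rem_ge_1:
  assumes "x \<ge> 1"
  shows "ncf_rem x n \<ge> 1"
proof (cases n)
  case (Suc m)
  have "0 < of_int \<lfloor>ncf_rem x m\<rfloor> + 1 - ncf_rem x m" "of_int \<lfloor>ncf_rem x m\<rfloor> + 1 - ncf_rem x m \<le> 1"
    by linarith+
  then show ?thesis using Suc by simp
qed (use assms in simp)

lemma ncf_expansion_exists:
  assumes "x \<ge> 1"
  shows "\<exists>c. is_ncf_expansion x c"
proof -
  define c where "c n = nat (\<lfloor>ncf_rem x n\<rfloor> + 1)" for n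
  have X1: "ncf_rem x n \<ge> 1" for n by (rule ncf_rem_ge_1[OF assms])
  have rc: "real (c n) = of_int \<lfloor>ncf_rem x n\<rfloor> + 1" for n
    using X1[of n] by (simp add: c_def)
  have c2: "c n \<ge> 2" for n
    using X1[of n] by (simp add: c_def le_nat_iff)
  have X: "ncf_rem x n = real (c n) - 1 / ncf_rem x (Suc n)" for n
    by (simp add: rc)
  have "\<exists>y. ncf_conv (\<lambda>j. c (n + j)) \<longlonglongrightarrow> y" for n
    using ncf_conv_convergent[of "\<lambda>j. c (n + j)"] c2 by blast
  then obtain Y where Y: "\<And>n. ncf_conv (\<lambda>j. c (n + j)) \<longlonglongrightarrow> Y n" by metis
  have eY: "is_ncf_expansion (Y n) (\<lambda>j. c (n + j))" for n
    using Y c2 by (simp add: is_ncf_expansion_def)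
  have Y1: "Y n \<ge> 1" for n using ncf_expansion_ge_1[OF eY] .
  have Yrec: "Y n = real (c n) - 1 / Y (Suc n)" for n
  proof -
    obtain y where y: "is_ncf_expansion y (\<lambda>j. c (n + Suc j))" "Y n = real (c (n + 0)) - 1 / y"
      using ncf_expansion_step[OF eY[of n]] by blast
    have "ncf_conv (\<lambda>j. c (Suc n + j)) \<longlonglongrightarrow> y" using y by (simp add: is_ncf_expansion_def)
    then have "y = Y (Suc n)" using Y LIMSEQ_unique by blast
    then show ?thesis using y by simp
  qed
  define D where "D n = \<bar>ncf_rem x n - Y n\<bar>" for n
  have Dle: "D n \<le> 1" for n
  proof -
    have "0 \<le> 1 / ncf_rem x (Suc n)" "1 / ncf_rem x (Suc n) \<le> 1"
      "0 \<le> 1 / Y (Suc n)" "1 / Y (Suc n) \<le> 1"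
      using X1[of "Suc n"] Y1[of "Suc n"] by (auto simp: divide_le_eq_1)
    then show ?thesis unfolding D_def X[of n] Yrec[of n] by linarith
  qed
  have Drec: "D (Suc n) = D n * (ncf_rem x (Suc n) * Y (Suc n))" for n
  proof -
    have p: "ncf_rem x (Suc n) > 0" "Y (Suc n) > 0"
      using X1[of "Suc n"] Y1[of "Suc n"] by linarith+
    have "ncf_rem x n - Y n = 1 / Y (Suc n) - 1 / ncf_rem x (Suc n)"
      using X[of n] Yrec[of n] by linarith
    then have "(ncf_rem x n - Y n) * (ncf_rem x (Suc n) * Y (Suc n)) = ncf_rem x (Suc n) - Y (Suc n)"
      using p by (simp add: left_diff_distrib del: ncf_rem.simps)
    then have "\<bar>ncf_rem x (Suc n) - Y (Suc n)\<bar> = \<bar>ncf_rem x n - Y n\<bar> * \<bar>ncf_rem x (Suc n) * Y (Suc n)\<bar>"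
      by (metis abs_mult)
    then show ?thesis using p by (simp add: D_def del: ncf_rem.simps)
  qed
  have grow: "D (Suc n) \<ge> D n * (1 + D (Suc n))" for n
  proof -
    define u v where "u = ncf_rem x (Suc n)" and "v = Y (Suc n)"
    have uv: "u \<ge> 1" "v \<ge> 1" unfolding u_def v_def by (rule X1 Y1)+
    have "0 \<le> (u - 1) * (v - 1)" using uv by simp
    then have 1: "u * v \<ge> u + v - 1" by (simp add: algebra_simps)
    have "u + v - 1 \<ge> 1 + \<bar>u - v\<bar>" using uv by linarith
    then have "u * v \<ge> 1 + D (Suc n)" using 1 unfolding D_def u_def v_def by linarith
    moreover have "D n \<ge> 0" by (simp add: D_def)
    ultimately show ?thesis unfolding Drec[of n] u_def v_def
      by (metis Drec mult_left_mono)
  qed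
  have D0: "D n \<ge> 0" for n by (simp add: D_def)
  have mono: "D n \<ge> D 0" for n
  proof (induction n)
    case (Suc n)
    have "D n \<le> D n * (1 + D (Suc n))" using D0[of n] D0[of "Suc n"] by (simp add: algebra_simps)
    then show ?case using grow[of n] Suc by linarith
  qed simp
  have lin: "D n \<ge> D 0 + real n * (D 0)\<^sup>2" for n
  proof (induction n)
    case (Suc n)
    have "D 0 * D 0 \<le> D n * D (Suc n)" using mono D0 by (intro mult_mono) auto
    then show ?case using grow[of n] Suc by (simp add: algebra_simps power2_eq_square)
  qed simp
  have "D 0 = 0"
  proof (rule ccontr)
    assume "D 0 \<noteq> 0"
    then have "(D 0)\<^sup>2 > 0" by simp
    then obtain n where "1 < real n * (D 0)\<^sup>2" using reals_Archimedean3 by blast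
    then show False using lin[of n] Dle[of n] D0[of 0] by linarith
  qed
  then have "Y 0 = x" by (simp add: D_def)
  then show ?thesis using eY[of 0] by auto
qed

lemma ex1_ncf_expansion: "x \<ge> 1 \<Longrightarrow> \<exists>!c. is_ncf_expansion x c"
  using ncf_expansion_exists ncf_expansion_unique by blast

lemma is_ncf_expansion_ncf: "x \<ge> 1 \<Longrightarrow> is_ncf_expansion x (ncf x)"
  unfolding ncf_def by (rule theI'[OF ex1_ncf_expansion])


subsection \<open>Convergence of the q-convergents\<close>

lemma q_int_coeff_0: "n \<ge> 1 \<Longrightarrow> coeff (q_int n) 0 = 1"
  by (simp add: q_int_def coeff_sum sum.If_cases)

lemma q_conv_nth_0:
  assumes "\<And>j. c j \<ge> 2"
  shows "fps_nth (q_conv c n) 0 = 1"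
proof -
  have "c 0 \<ge> 2" by (rule assms)
  then show ?thesis by (cases n) (simp_all add: q_int_coeff_0)
qed

lemma q_conv_diff:
  assumes "\<And>j. c j \<ge> 2"
  shows "fps_X ^ Suc n dvd q_conv c n - q_conv c (n + k)"
  using assms
proof (induction n arbitrary: c)
  case 0
  have "c 0 \<ge> 2" by (rule 0)
  show ?case
  proof (cases k)
    case (Suc m)
    have "fps_X dvd (fps_X ^ (c 0 - 1) :: int fps)" using \<open>c 0 \<ge> 2\<close> by (simp add: dvd_power)
    then show ?thesis using Suc by simp
  qed simp
next
  case (Suc n)
  let ?d = "\<lambda>j. c (Suc j)"
  let ?A = "q_conv ?d n" and ?B = "q_conv ?d (n + k)"
  have d: "\<And>j. ?d j \<ge> 2" using Suc.prems by blast
  have A: "?A * fps_recip ?A = 1" and B: "?B * fps_recip ?B = 1"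
    using fps_recip q_conv_nth_0[of ?d] d by blast+
  have IH: "fps_X ^ Suc n dvd ?A - ?B" by (rule Suc.IH) (rule d)
  have "fps_recip ?B - fps_recip ?A = (?A * fps_recip ?A) * fps_recip ?B - (?B * fps_recip ?B) * fps_recip ?A"
    unfolding A B by simp
  also have "\<dots> = (?A - ?B) * (fps_recip ?A * fps_recip ?B)" by (simp add: algebra_simps)
  finally have "fps_X ^ Suc n dvd fps_recip ?B - fps_recip ?A" using IH by simp
  moreover have "(fps_X :: int fps) dvd fps_X ^ (c 0 - 1)"
    using Suc.prems[of 0] by (simp add: dvd_power)
  ultimately have "fps_X * fps_X ^ Suc n dvd fps_X ^ (c 0 - 1) * (fps_recip ?B - fps_recip ?A)"
    by (intro mult_dvd_mono)
  then show ?case by (simp add: algebra_simps)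
qed

lemma q_conv_tendsto:
  assumes "\<And>j. c j \<ge> 2"
  obtains f where "q_conv c \<longlonglongrightarrow> f"
proof -
  have "fps_nth (q_conv c (n + k)) n = fps_nth (q_conv c n) n" for n k
  proof -
    obtain g where "q_conv c n - q_conv c (n + k) = fps_X ^ Suc n * g"
      using q_conv_diff[of c n k] assms by (auto elim: dvdE simp del: power_Suc)
    then have "fps_nth (q_conv c n - q_conv c (n + k)) n = fps_nth (fps_X ^ Suc n * g) n" by simp
    then show ?thesis by (simp add: fps_X_power_mult_nth del: power_Suc)
  qed
  then have "eventually (\<lambda>m. fps_nth (q_conv c m) n = fps_nth (Abs_fps (\<lambda>n. fps_nth (q_conv c n) n)) n) sequentially" for n
    unfolding eventually_sequentially by (intro exI[of _ n]) (auto simp: le_iff_add)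
  then have "q_conv c \<longlonglongrightarrow> Abs_fps (\<lambda>n. fps_nth (q_conv c n) n)" by (rule tendsto_fpsI)
  then show ?thesis by (rule that)
qed

lemma q_conv_tendsto_q_real:
  assumes "x \<ge> 1"
  shows "q_conv (ncf x) \<longlonglongrightarrow> q_real x"
proof -
  have c: "\<And>j. ncf x j \<ge> 2" using is_ncf_expansion_ncf[OF assms] by (auto simp: is_ncf_expansion_def)
  obtain f where "q_conv (ncf x) \<longlonglongrightarrow> f" using q_conv_tendsto[of "ncf x"] c by blast
  then show ?thesis unfolding q_real_def using limI by blast
qed

lemma q_real_nth_0:
  assumes "x \<ge> 1"
  shows "fps_nth (q_real x) 0 = 1"
proof -
  have c: "\<And>j. ncf x j \<ge> 2" using is_ncf_expansion_ncf[OF assms] by (auto simp: is_ncf_expansion_def)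
  have "eventually (\<lambda>m. fps_nth (q_conv (ncf x) m) 0 = fps_nth (q_real x) 0) sequentially"
    using q_conv_tendsto_q_real[OF assms] by (simp add: tendsto_fps_iff)
  then obtain m where "fps_nth (q_conv (ncf x) m) 0 = fps_nth (q_real x) 0"
    using eventually_happens' sequentially_bot by blast
  moreover have "fps_nth (q_conv (ncf x) m) 0 = 1" using q_conv_nth_0 c by blast
  ultimately show ?thesis by simp
qed

lemma a_poly_coeff_0:
  assumes "\<And>j. c j \<ge> 2"
  shows "coeff (a_poly c N) 0 = 1"
  using assms
proof (induction c N rule: a_poly.induct)
  case (2 c)
  have "c 0 \<ge> 2" by (rule 2)
  then show ?case by (simp add: q_int_coeff_0)
next
  case (3 c N)
  have c: "c (Suc N) \<ge> 2" "c N \<ge> 2" by (rule 3)+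
  have "coeff (q_int (c (Suc N))) 0 = 1" using c by (intro q_int_coeff_0) simp
  moreover have "\<not> c N \<le> Suc 0" using c by simp
  ultimately show ?case using 3 by (simp add: coeff_mult)
qed simp

end

theory Submission
  imports Defs
begin

text \<open>
Write $a_N$ for the polynomials of the sequence $c$ and $b_{n+1}$ for the polynomial of index $n$
of the shifted sequence $c_2, c_3, \dots$. Both obey the same three-term recursion, so their
Casoratian is $b_{N+1} a_N - b_N a_{N+1} = q^{C_N}$, the series telescopes, and its partial sums
are $b_n / a_n$. These quotients are the reciprocals of the $q$-convergents of $[x]_q$. Since taking
reciprocals is $q$-adically continuous, this gives the identity of formal power series
(\<open>fps_term_sums\<close>).

For real $q$ everything rests on lower bounds for $a_N(q)$. If $0 \le q < 1$, the sequence
$a_N(q)$ is nondecreasing and starts at 1, so the $N$-th term is at most $q^N$.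

Let $q = -r$ with $0 \le r < R_*$, that is, $r < (1-r)^2$. In
$a_{N+1} = [c_{N+1}] a_N - q^{c_N - 1} a_{N-1}$ the last term helps when $c_N$ is even and hurts when
$c_N$ is odd. To absorb it, follow $a_N - s_{c_N} a_{N-1}$ instead of $a_N$, where $s_n = r^{n-2}$
for odd $n$ and $s_n = 0$ for even $n$. Each step multiplies this quantity by at least
$m_n = [n] - s_n$, where $n$ is the new entry, and the bound $m_n \ge (1-r)^2 > r$ is what makes this
work. Hence $a_N \ge \prod_{j \le N} m_{c_j}$ (\<open>a_eval_neg_lower\<close>). Moreover
$r^{n-1} \le \kappa m_n^2$ with $\kappa = r / (1-r)^2 < 1$, so the numerator $r^{C_N}$ is at most
$\kappa^N$ times the square of that product, and the terms decay like $\kappa^N$. The entry $n = 3$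
is the tight one: there $m_3 = (1-r)^2$, and at $r = R_*$ nothing is gained any more.

Both rates are continuous in $q$, so they are bounded away from 1 on compact sets and the
Weierstrass test yields uniform convergence and continuity. Finally the sum $S$ is a limit of
positive numbers, and it satisfies $S \cdot ([c_1]_q - q^{c_1-1} S') = 1$ where $S'$ is the
sum for the shifted sequence; so $S \ne 0$, and therefore $S > 0$.
\<close>

section \<open>Continuant identities\<close>

text \<open>
The defining recursion of \<open>a_poly\<close> adds an entry at the end, whereas finite continued
fractions grow at the front; this symmetry of continuants links the two.
\<close>

lemma a_poly_front_recursion:
  "a_poly c (Suc (Suc n)) =
     q_int (c 0) * a_poly (\<lambda>j. c (Suc j)) (Suc n)
     - monom 1 (c 0 - 1) * a_poly (\<lambda>j. c (Suc (Suc j))) n"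
proof (induction n rule: induct_nat_012)
  case (ge2 n)
  have "a_poly c (Suc (Suc (Suc (Suc n)))) =
      q_int (c (Suc (Suc (Suc n)))) * a_poly c (Suc (Suc (Suc n)))
      - monom 1 (c (Suc (Suc n)) - 1) * a_poly c (Suc (Suc n))"
    by (rule a_poly.simps)
  then show ?case
    unfolding ge2 by (simp only: a_poly.simps(3)) (simp add: algebra_simps)
qed (simp_all add: algebra_simps)

text \<open>
The numerator produced by subtracting consecutive quotients $b_{n+1} / a_{n+1}$ and
$b_{n+2} / a_{n+2}$. One step of the common recursion multiplies it by
\<open>q ^ (c (Suc n) - 1)\<close>.
\<close>

lemma a_poly_determinant:
  "a_poly (\<lambda>j. c (Suc j)) (Suc n) * a_poly c (Suc n)
     - a_poly (\<lambda>j. c (Suc j)) n * a_poly c (Suc (Suc n)) = monom 1 (C_exp c (Suc n))"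
proof (induction n)
  case 0
  then show ?case by (simp add: C_exp_def algebra_simps)
next
  case (Suc n)
  have "monom 1 (C_exp c (Suc (Suc n))) =
      monom 1 (c (Suc n) - 1) * (monom 1 (C_exp c (Suc n)) :: int poly)"
    by (simp add: C_exp_def mult_monom add.commute)
  then show ?case
    unfolding Suc[symmetric] by (simp add: algebra_simps)
qed

lemma q_conv_times_a_poly:
  assumes "\<And>j. c j \<ge> 2"
  shows "q_conv c n * fps_of_poly (a_poly (\<lambda>j. c (Suc j)) n) = fps_of_poly (a_poly c (Suc n))"
  using assms
proof (induction n arbitrary: c)
  case (Suc n)
  let ?d = "\<lambda>j. c (Suc j)"
  let ?e = "\<lambda>j. c (Suc (Suc j))"
  have d: "\<And>j. ?d j \<ge> 2" using Suc.prems by blast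
  have IH: "q_conv ?d n * fps_of_poly (a_poly ?e n) = fps_of_poly (a_poly ?d (Suc n))"
    by (rule Suc.IH) (rule d)
  have inv: "q_conv ?d n * fps_recip (q_conv ?d n) = 1"
    using fps_recip q_conv_nth_0[of ?d] d by blast
  have "fps_recip (q_conv ?d n) * fps_of_poly (a_poly ?d (Suc n)) =
      (q_conv ?d n * fps_recip (q_conv ?d n)) * fps_of_poly (a_poly ?e n)"
    unfolding IH[symmetric] by (simp add: algebra_simps)
  then have *: "fps_recip (q_conv ?d n) * fps_of_poly (a_poly ?d (Suc n)) = fps_of_poly (a_poly ?e n)"
    by (simp only: inv mult_1_left)
  show ?case
    unfolding a_poly_front_recursion q_conv.simps
    by (simp only: left_diff_distrib fps_of_poly_diff fps_of_poly_mult fps_of_poly_monom' mult.assoc *)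
qed simp


section \<open>The identity of formal power series\<close>

lemma fps_recip_unique:
  assumes "fps_nth f 0 = 1" "f * g = 1"
  shows "g = fps_recip f"
proof -
  have "g = (f * fps_recip f) * g" using fps_recip[OF assms(1)] by simp
  also have "\<dots> = fps_recip f * (f * g)" by (simp add: mult_ac)
  finally show ?thesis using assms(2) by simp
qed

text \<open>
Applied with \<open>h\<close> a power of \<open>fps_X\<close>: reciprocals agree to the same $q$-adic precision as
the series themselves.
\<close>

lemma fps_recip_cong_mod:
  assumes "fps_nth f 0 = 1" "fps_nth g 0 = 1" "h dvd f - g"
  shows "h dvd fps_recip g - fps_recip f"
proof -
  have "fps_recip g - fps_recip f = (f * fps_recip f) * fps_recip g - (g * fps_recip g) * fps_recip f"
    using assms(1,2) by (simp add: fps_recip)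
  also have "\<dots> = (f - g) * (fps_recip f * fps_recip g)"
    by (simp add: algebra_simps)
  finally show ?thesis using assms(3) by simp
qed

lemma fps_X_power_dvd_iff_nth:
  fixes f :: "'a::comm_ring_1 fps"
  shows "fps_X ^ n dvd f \<longleftrightarrow> (\<forall>k<n. fps_nth f k = 0)"
proof
  assume "fps_X ^ n dvd f"
  then show "\<forall>k<n. fps_nth f k = 0" by (auto elim!: dvdE simp: fps_X_power_mult_nth)
next
  assume "\<forall>k<n. fps_nth f k = 0"
  then have "f = fps_X ^ n * fps_shift n f"
    by (intro fps_ext) (simp add: fps_X_power_mult_nth)
  then show "fps_X ^ n dvd f" by (metis dvd_triv_left)
qed

lemma tendsto_fps_recip:
  assumes "F \<longlonglongrightarrow> f" "\<And>n. fps_nth (F n) 0 = 1" "fps_nth f 0 = 1"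
  shows "(\<lambda>n. fps_recip (F n)) \<longlonglongrightarrow> fps_recip f"
proof (rule tendsto_fpsI)
  fix k
  have "\<forall>i. eventually (\<lambda>n. fps_nth (F n) i = fps_nth f i) sequentially"
    using assms(1) by (simp add: tendsto_fps_iff)
  then have "eventually (\<lambda>n. \<forall>i\<in>{..<Suc k}. fps_nth (F n) i = fps_nth f i) sequentially"
    by (intro eventually_ball_finite) auto
  then show "eventually (\<lambda>n. fps_nth (fps_recip (F n)) k = fps_nth (fps_recip f) k) sequentially"
  proof eventually_elim
    case (elim n)
    then have "fps_X ^ Suc k dvd f - F n" by (simp add: fps_X_power_dvd_iff_nth del: power_Suc)
    then have "fps_X ^ Suc k dvd fps_recip (F n) - fps_recip f"
      using assms(2,3) by (intro fps_recip_cong_mod)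
    then show ?case by (simp add: fps_X_power_dvd_iff_nth del: power_Suc)
  qed
qed

lemma sum_fps_term:
  assumes "\<And>j. c j \<ge> 2"
  shows "(\<Sum>N<Suc n. fps_term c N) = fps_recip (q_conv c n)"
proof -
  let ?a = "\<lambda>n. fps_of_poly (a_poly c n)" and ?b = "\<lambda>n. fps_of_poly (a_poly (\<lambda>j. c (Suc j)) n)"
  have a0: "fps_nth (?a n) 0 = 1" for n
    using a_poly_coeff_0[of c n] assms by simp
  have trm: "fps_term c n * (?a n * ?a (Suc n)) = fps_X ^ C_exp c n" for n
  proof -
    have "fps_nth (?a n * ?a (Suc n)) 0 = 1" using a0[of n] a0[of "Suc n"] by simp
    then have "(?a n * ?a (Suc n)) * fps_recip (?a n * ?a (Suc n)) = 1" by (rule fps_recip)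
    then have "fps_X ^ C_exp c n * ((?a n * ?a (Suc n)) * fps_recip (?a n * ?a (Suc n))) = fps_X ^ C_exp c n"
      by simp
    then show ?thesis
      unfolding fps_term_def by (simp only: fps_of_poly_mult mult_ac)
  qed
  have nz: "?a n \<noteq> 0" for n using a0[of n] by fastforce
  have "(\<Sum>N<Suc n. fps_term c N) * ?a (Suc n) = ?b n"
  proof (induction n)
    case 0
    then show ?case using trm[of 0] by (simp add: C_exp_def)
  next
    case (Suc n)
    have det: "fps_X ^ C_exp c (Suc n) = ?b (Suc n) * ?a (Suc n) - ?b n * ?a (Suc (Suc n))"
      unfolding fps_of_poly_monom'[symmetric] a_poly_determinant[symmetric]
      by (simp only: fps_of_poly_diff fps_of_poly_mult)
    \<comment> \<open>Multiplying by the previous denominator as well keeps the computation free of reciprocals.\<close>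
    have "(\<Sum>N<Suc (Suc n). fps_term c N) * ?a (Suc (Suc n)) * ?a (Suc n) =
        (\<Sum>N<Suc n. fps_term c N) * ?a (Suc n) * ?a (Suc (Suc n))
        + fps_term c (Suc n) * (?a (Suc n) * ?a (Suc (Suc n)))"
      by (subst sum.lessThan_Suc) (simp only: algebra_simps)
    also have "\<dots> = ?b (Suc n) * ?a (Suc n)"
      unfolding Suc trm det by simp
    finally show ?case using nz[of "Suc n"] by (metis mult_right_cancel)
  qed
  then have "?a (Suc n) * (q_conv c n * (\<Sum>N<Suc n. fps_term c N)) = ?a (Suc n) * 1"
    using q_conv_times_a_poly[of c n] assms by (simp only: mult_ac) simp
  then have "q_conv c n * (\<Sum>N<Suc n. fps_term c N) = 1"
    using nz[of "Suc n"] by (metis mult_left_cancel)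
  then show ?thesis
    using q_conv_nth_0[of c n] assms by (intro fps_recip_unique) auto
qed

lemma fps_term_sums:
  assumes "x \<ge> 1"
  shows "fps_term (ncf x) sums fps_recip (q_real x)"
proof -
  have c: "\<And>j. ncf x j \<ge> 2"
    using is_ncf_expansion_ncf[OF assms] by (auto simp: is_ncf_expansion_def)
  have "(\<lambda>n. fps_recip (q_conv (ncf x) n)) \<longlonglongrightarrow> fps_recip (q_real x)"
    using q_conv_tendsto_q_real[OF assms] q_real_nth_0[OF assms] q_conv_nth_0[of "ncf x"] c
    by (intro tendsto_fps_recip) auto
  then have "(\<lambda>n. \<Sum>N<Suc n. fps_term (ncf x) N) \<longlonglongrightarrow> fps_recip (q_real x)"
    using sum_fps_term[of "ncf x"] c by simp
  then show ?thesis unfolding sums_def by (rule LIMSEQ_imp_Suc)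
qed


section \<open>Real values of the continuants\<close>

definition q_num :: "nat \<Rightarrow> real \<Rightarrow> real" where
  "q_num n q = (\<Sum>i<n. q ^ i)"

lemma poly_of_int_hom:
  fixes q :: real
  shows "poly (map_poly of_int (p + r)) q = poly (map_poly of_int p) q + poly (map_poly of_int r) q"
    and "poly (map_poly of_int (p - r)) q = poly (map_poly of_int p) q - poly (map_poly of_int r) q"
    and "poly (map_poly of_int (p * r)) q = poly (map_poly of_int p) q * poly (map_poly of_int r) q"
proof -
  have add: "map_poly (of_int :: int \<Rightarrow> real) (p + r) = map_poly of_int p + map_poly of_int r" for p r
    by (intro poly_eqI) (simp add: coeff_map_poly)
  have diff: "map_poly (of_int :: int \<Rightarrow> real) (p - r) = map_poly of_int p - map_poly of_int r"
    by (intro poly_eqI) (simp add: coeff_map_poly)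
  have mult: "map_poly (of_int :: int \<Rightarrow> real) (p * r) = map_poly of_int p * map_poly of_int r"
    by (intro poly_eqI) (simp add: coeff_map_poly coeff_mult)
  show "poly (map_poly of_int (p + r)) q = poly (map_poly of_int p) q + poly (map_poly of_int r) q"
    "poly (map_poly of_int (p - r)) q = poly (map_poly of_int p) q - poly (map_poly of_int r) q"
    "poly (map_poly of_int (p * r)) q = poly (map_poly of_int p) q * poly (map_poly of_int r) q"
    by (simp_all add: add diff mult)
qed

lemma poly_of_int_monom: "poly (map_poly of_int (monom 1 n)) (q :: real) = q ^ n"
  by (simp add: map_poly_monom poly_monom)

lemma poly_of_int_q_int: "poly (map_poly of_int (q_int n)) q = q_num n q"
proof (induction n)
  case (Suc n)
  have "q_int (Suc n) = q_int n + monom 1 n" by (simp add: q_int_def add.commute)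
  then show ?case using Suc by (simp add: poly_of_int_hom poly_of_int_monom q_num_def)
qed (simp add: q_int_def q_num_def)

lemma a_eval_simps:
  "a_eval c 0 q = 1"
  "a_eval c (Suc 0) q = q_num (c 0) q"
  "a_eval c (Suc (Suc N)) q =
     q_num (c (Suc N)) q * a_eval c (Suc N) q - q ^ (c N - 1) * a_eval c N q"
  by (simp_all add: a_eval_def poly_of_int_hom poly_of_int_monom poly_of_int_q_int)

lemma a_eval_front_recursion:
  "a_eval c (Suc (Suc n)) q =
     q_num (c 0) q * a_eval (\<lambda>j. c (Suc j)) (Suc n) q
     - q ^ (c 0 - 1) * a_eval (\<lambda>j. c (Suc (Suc j))) n q"
  unfolding a_eval_def a_poly_front_recursion
  by (simp only: poly_of_int_hom poly_of_int_monom poly_of_int_q_int)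

lemma a_eval_determinant:
  "a_eval (\<lambda>j. c (Suc j)) (Suc n) q * a_eval c (Suc n) q
     - a_eval (\<lambda>j. c (Suc j)) n q * a_eval c (Suc (Suc n)) q = q ^ C_exp c (Suc n)"
  unfolding a_eval_def
  by (simp only: poly_of_int_hom(2,3)[symmetric] a_poly_determinant poly_of_int_monom)

lemma continuous_on_a_eval: "continuous_on A (a_eval c N)"
  unfolding a_eval_def by (intro continuous_intros)

lemma sum_real_term:
  assumes "\<And>N. a_eval c N q \<noteq> 0"
  shows "(\<Sum>N<Suc n. real_term c N q) = a_eval (\<lambda>j. c (Suc j)) n q / a_eval c (Suc n) q"
proof (induction n)
  case 0
  then show ?case by (simp add: real_term_def C_exp_def a_eval_simps)
next
  case (Suc n)
  have nz: "a_eval c (Suc n) q \<noteq> 0" "a_eval c (Suc (Suc n)) q \<noteq> 0" by (rule assms)+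
  have "(\<Sum>N<Suc (Suc n). real_term c N q) =
      a_eval (\<lambda>j. c (Suc j)) n q / a_eval c (Suc n) q + real_term c (Suc n) q"
    by (simp only: sum.lessThan_Suc[of _ "Suc n"] Suc)
  also have "\<dots> = a_eval (\<lambda>j. c (Suc j)) (Suc n) q / a_eval c (Suc (Suc n)) q"
    unfolding real_term_def a_eval_determinant[symmetric]
    using nz by (simp add: divide_simps del: a_eval_simps)
  finally show ?case .
qed


section \<open>Bounds for nonnegative q\<close>

text \<open>
With $[n]_q \ge 1 + q$ and $q^{n-1} \le q$ for $n \ge 2$, the recursion gives
$a_{N+2} - a_{N+1} \ge q (a_{N+1} - a_N)$, so the sequence never decreases.
\<close>

lemma a_eval_ge_1:
  assumes c: "\<And>j. c j \<ge> 2" and q: "0 \<le> q" "q \<le> 1"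
  shows "a_eval c N q \<ge> 1"
proof -
  have num: "q_num n q \<ge> 1 + q" if "n \<ge> 2" for n
  proof -
    have "(\<Sum>i<2. q ^ i) \<le> (\<Sum>i<n. q ^ i)"
      using that q by (intro sum_mono2) auto
    then show ?thesis by (simp add: q_num_def numeral_2_eq_2)
  qed
  \<comment> \<open>The second conjunct is what carries the induction.\<close>
  have "a_eval c N q \<ge> 1 \<and> a_eval c (Suc N) q \<ge> a_eval c N q"
  proof (induction N)
    case 0
    then show ?case using num[OF c[of 0]] q by (simp add: a_eval_simps)
  next
    case (Suc N)
    have "q ^ (c N - 1) \<le> q ^ 1"
      using c[of N] q by (intro power_decreasing) auto
    then have "q ^ (c N - 1) * a_eval c N q \<le> q * a_eval c (Suc N) q"
      using Suc q by (intro mult_mono) auto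
    moreover have "(1 + q) * a_eval c (Suc N) q \<le> q_num (c (Suc N)) q * a_eval c (Suc N) q"
      using num[OF c[of "Suc N"]] Suc by (intro mult_right_mono) auto
    ultimately show ?case using Suc by (simp add: a_eval_simps algebra_simps)
  qed
  then show ?thesis by blast
qed

lemma C_exp_ge:
  assumes "\<And>j. c j \<ge> 2"
  shows "N \<le> C_exp c N"
proof (induction N)
  case (Suc N)
  then show ?case using assms[of N] by (simp add: C_exp_def)
qed simp

lemma real_term_bound_nonneg:
  assumes c: "\<And>j. c j \<ge> 2" and q: "0 \<le> q" "q \<le> 1"
  shows "\<bar>real_term c N q\<bar> \<le> q ^ N"
proof -
  have a: "a_eval c n q \<ge> 1" for n by (rule a_eval_ge_1) (fact c q)+
  then have "1 * 1 \<le> a_eval c N q * a_eval c (Suc N) q"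
    using order_trans[OF zero_le_one a] by (intro mult_mono) auto
  then have "q ^ C_exp c N / (a_eval c N q * a_eval c (Suc N) q) \<le> q ^ C_exp c N / 1"
    using q by (intro divide_left_mono) auto
  also have "\<dots> \<le> q ^ N"
    using C_exp_ge[of c N] assms by (simp add: power_decreasing)
  finally show ?thesis
    using a[of N] a[of "Suc N"] q by (simp add: real_term_def abs_mult)
qed


section \<open>Bounds for negative q\<close>

text \<open>
The multiple of $a_{N-1}$ that is set aside from $a_N$ when the last entry is \<open>n\<close>, at
$q = -r$. For odd \<open>n\<close> it must satisfy $m s \ge r^{n-1}$ for every growth factor $m$; as these
are at least $r$, the power $r^{n-2}$ suffices. For even \<open>n\<close> the recursion adds a nonnegative
term and nothing has to be set aside.
\<close>

definition deficit :: "nat \<Rightarrow> real \<Rightarrow> real" where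
  "deficit n r = (if odd n then r ^ (n - 2) else 0)"

definition growth :: "nat \<Rightarrow> real \<Rightarrow> real" where
  "growth n r = q_num n (- r) - deficit n r"

text \<open>
Multiply by $1 + r$ to turn $[n]$ into $1 - (-r)^n$. For even $n$ the worst case is then $n = 2$.
For odd $n$ the claim becomes $r^{n-2} (1 + r - r^2) \le r (1 + r - r^2)$, with equality
for $n = 3$.
\<close>

lemma growth_ge:
  assumes r: "0 \<le> r" "r \<le> 1" and n: "n \<ge> 2"
  shows "even n \<Longrightarrow> growth n r \<ge> 1 - r" and "odd n \<Longrightarrow> growth n r \<ge> (1 - r)\<^sup>2"
proof -
  have geo: "(1 + r) * q_num n (- r) = 1 - (- r) ^ n"
    using one_diff_power_eq[of "- r" n] by (simp add: q_num_def)
  show "growth n r \<ge> 1 - r" if "even n"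
  proof -
    have "r ^ n \<le> r ^ 2" using r n by (intro power_decreasing) auto
    then have "(1 + r) * (1 - r) \<le> (1 + r) * q_num n (- r)"
      using that unfolding geo by (simp add: algebra_simps power2_eq_square)
    then show ?thesis using r that by (simp add: growth_def deficit_def)
  qed
  show "growth n r \<ge> (1 - r)\<^sup>2" if "odd n"
  proof -
    have "n \<noteq> 2" using that by auto
    then have "3 \<le> n" using n by simp
    then obtain m where "n = 3 + m" using le_Suc_ex by blast
    then have m: "n = Suc (Suc (Suc m))" by simp
    \<comment> \<open>Here m = n - 3, so the case m = 0 is the extremal entry 3.\<close>
    have "r ^ m * (r * (1 + r - r\<^sup>2)) \<le> 1 * (r * (1 + r - r\<^sup>2))"
    proof (rule mult_right_mono)
      show "r ^ m \<le> 1" using r by (simp add: power_le_one)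
      have "r\<^sup>2 \<le> 1" using r by (simp add: power_le_one)
      then show "0 \<le> r * (1 + r - r\<^sup>2)" using r by simp
    qed
    then have "(1 + r) * (1 - r)\<^sup>2 \<le> (1 + r) * (q_num n (- r) - r ^ (n - 2))"
      using that geo by (simp add: m algebra_simps power2_eq_square)
    then show ?thesis using r that by (simp add: growth_def deficit_def)
  qed
qed

context
  fixes r :: real
  assumes r: "0 \<le> r" "r < 1" "r < (1 - r)\<^sup>2"
begin

lemma growth_lower:
  assumes "n \<ge> 2"
  shows "growth n r \<ge> (1 - r)\<^sup>2" "growth n r > r" "growth n r > 0"
proof -
  have "(1 - r) * (1 - r) \<le> (1 - r) * 1" using r by (intro mult_left_mono) auto
  then have "(1 - r)\<^sup>2 \<le> 1 - r" by (simp add: power2_eq_square)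
  then show "growth n r \<ge> (1 - r)\<^sup>2"
    using growth_ge[of r n] r assms by (cases "even n") auto
  then show "growth n r > r" "growth n r > 0" using r by auto
qed

text \<open>
The step condition: at a transition from an entry \<open>m\<close> to an entry \<open>n\<close>, the amount set aside
pays for the subtracted term of the recursion.
\<close>

lemma growth_times_deficit:
  assumes "n \<ge> 2" "m \<ge> 2"
  shows "growth n r * deficit m r \<ge> (- r) ^ (m - 1)"
proof (cases "even m")
  case True
  then show ?thesis using r assms by (simp add: deficit_def)
next
  case False
  obtain k where "m = 2 + k" using le_Suc_ex[OF assms(2)] by blast
  then have k: "m = Suc (Suc k)" by simp
  have "r * r ^ k \<le> growth n r * r ^ k"
    using growth_lower(2)[OF assms(1)] r by (intro mult_right_mono) auto
  then show ?thesis using False by (simp add: deficit_def k)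
qed

text \<open>
For even $n$ the claim follows from $m_n \ge 1 - r$ and $r^{n-1} \le r$. For odd $n$ only
$m_n \ge (1-r)^2$ is available, but then $n \ge 3$ and $r^{n-1} \le r^2 \le r (1-r)^2$.
\<close>

lemma power_le_growth_square:
  assumes "n \<ge> 2"
  shows "r ^ (n - 1) \<le> r / (1 - r)\<^sup>2 * (growth n r)\<^sup>2"
proof (cases "even n")
  case True
  have "r ^ (n - 1) \<le> r ^ 1" using r assms by (intro power_decreasing) auto
  also have "\<dots> = r / (1 - r)\<^sup>2 * (1 - r)\<^sup>2" using r by simp
  also have "\<dots> \<le> r / (1 - r)\<^sup>2 * (growth n r)\<^sup>2"
    using growth_ge(1)[of r n] True r assms by (intro mult_left_mono power_mono) auto
  finally show ?thesis .
next
  case False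
  then have "n \<ge> 3" using assms by (cases "n = 2") auto
  then have "r ^ (n - 1) \<le> r ^ 2" using r by (intro power_decreasing) auto
  also have "\<dots> \<le> r * (1 - r)\<^sup>2" using r by (simp add: power2_eq_square[of r] mult_left_mono)
  also have "\<dots> = r / (1 - r)\<^sup>2 * ((1 - r)\<^sup>2)\<^sup>2" using r by (simp add: power2_eq_square)
  also have "\<dots> \<le> r / (1 - r)\<^sup>2 * (growth n r)\<^sup>2"
    using growth_lower(1)[OF assms] r by (intro mult_left_mono power_mono) auto
  finally show ?thesis .
qed

text \<open>
The induction shows that $a_{N+1} - s a_N$, with $s$ the deficit of the latest entry,
grows by the factor \<open>growth\<close> at each step. Discarding $s a_N \ge 0$ gives the bound.
\<close>

lemma a_eval_neg_lower:
  assumes c: "\<And>j. c j \<ge> 2"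
  shows "a_eval c N (- r) \<ge> (\<Prod>j<N. growth (c j) r)"
proof -
  let ?a = "\<lambda>N. a_eval c N (- r)" and ?P = "\<lambda>N. \<Prod>j<N. growth (c j) r"
  have P: "?P N > 0" for N using growth_lower(3) c by (intro prod_pos) auto
  have s: "deficit n r \<ge> 0" for n using r by (simp add: deficit_def)
  have "?a N \<ge> ?P N \<and> ?a (Suc N) - deficit (c N) r * ?a N \<ge> ?P (Suc N)"
  proof (induction N)
    case 0
    then show ?case by (simp add: a_eval_simps growth_def)
  next
    case (Suc N)
    let ?m = "growth (c (Suc N)) r"
    have a: "?a N > 0" using Suc P[of N] by linarith
    have "?m * ?P (Suc N) \<le> ?m * (?a (Suc N) - deficit (c N) r * ?a N)"
      using Suc growth_lower(3)[OF c] by (intro mult_left_mono) (auto simp: less_imp_le)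
    also have "\<dots> = ?m * ?a (Suc N) - ?m * deficit (c N) r * ?a N" by (simp add: algebra_simps)
    also have "\<dots> \<le> ?m * ?a (Suc N) - (- r) ^ (c N - 1) * ?a N"
      using growth_times_deficit[OF c c] a by (intro diff_left_mono mult_right_mono) auto
    also have "\<dots> = ?a (Suc (Suc N)) - deficit (c (Suc N)) r * ?a (Suc N)"
      by (simp add: a_eval_simps growth_def algebra_simps)
    finally have "?P (Suc (Suc N)) \<le> ?a (Suc (Suc N)) - deficit (c (Suc N)) r * ?a (Suc N)"
      by (simp only: prod.lessThan_Suc[of _ "Suc N"] mult.commute)
    moreover have "?P (Suc N) \<le> ?a (Suc N)"
      using Suc mult_nonneg_nonneg[OF s[of "c N"] less_imp_le[OF a]] by linarith
    ultimately show ?case by blast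
  qed
  then show ?thesis by blast
qed

lemma a_eval_neg_pos:
  assumes c: "\<And>j. c j \<ge> 2"
  shows "a_eval c N (- r) > 0"
proof -
  have "(\<Prod>j<N. growth (c j) r) > 0" using growth_lower(3) c by (intro prod_pos) auto
  then show ?thesis using a_eval_neg_lower[of c N] c by fastforce
qed

text \<open>
The denominator $a_N a_{N+1}$ is at least the square of the product of the first $N$ growth
factors times one further factor, which is at least $(1-r)^2$; the numerator is at most
$\kappa^N$ times the same square.
\<close>

lemma real_term_bound_neg:
  assumes c: "\<And>j. c j \<ge> 2"
  shows "\<bar>real_term c N (- r)\<bar> \<le> (r / (1 - r)\<^sup>2) ^ N / (1 - r)\<^sup>2"
proof -
  let ?a = "\<lambda>N. a_eval c N (- r)" and ?P = "\<Prod>j<N. growth (c j) r" and ?k = "r / (1 - r)\<^sup>2"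
  have P: "?P > 0" using growth_lower(3) c by (intro prod_pos) auto
  have "r ^ C_exp c N = (\<Prod>j<N. r ^ (c j - 1))" by (simp add: C_exp_def power_sum)
  also have "\<dots> \<le> (\<Prod>j<N. ?k * (growth (c j) r)\<^sup>2)"
    using power_le_growth_square c r by (intro prod_mono) auto
  also have "\<dots> = ?k ^ N * (?P * ?P)"
    by (simp only: prod.distrib prod_constant card_lessThan power2_eq_square)
  finally have "r ^ C_exp c N * (1 - r)\<^sup>2 \<le> ?k ^ N * (?P * ?P) * (1 - r)\<^sup>2"
    by (intro mult_right_mono) auto
  also have "\<dots> = ?k ^ N * (?P * (?P * (1 - r)\<^sup>2))" by (simp only: mult.assoc)
  also have "\<dots> \<le> ?k ^ N * (?a N * ?a (Suc N))"
  proof (intro mult_left_mono mult_mono)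
    show "?P \<le> ?a N" by (rule a_eval_neg_lower) (rule c)
    have "?P * (1 - r)\<^sup>2 \<le> ?P * growth (c N) r"
      using P growth_lower(1)[OF c] by (intro mult_left_mono) auto
    also have "\<dots> \<le> ?a (Suc N)" using a_eval_neg_lower[of c "Suc N"] c by simp
    finally show "?P * (1 - r)\<^sup>2 \<le> ?a (Suc N)" .
  qed (use P r a_eval_neg_pos[of c N] c in \<open>auto simp: less_imp_le\<close>)
  finally have main: "r ^ C_exp c N * (1 - r)\<^sup>2 \<le> ?k ^ N * (?a N * ?a (Suc N))" .
  have pos: "?a N * ?a (Suc N) > 0" using a_eval_neg_pos[of c] c by simp
  have "\<bar>real_term c N (- r)\<bar> = r ^ C_exp c N / (?a N * ?a (Suc N))"
    using abs_of_pos[OF pos] r by (simp add: real_term_def abs_divide power_abs)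
  also have "\<dots> \<le> ?k ^ N / (1 - r)\<^sup>2"
    using main pos r by (subst pos_divide_le_eq) (auto simp: field_simps)
  finally show ?thesis .
qed

end


section \<open>The series on the whole interval\<close>

lemma R_star_less: "R_star < 2 / 5"
proof -
  have "11 / 5 < sqrt 5" by (rule real_less_rsqrt) (simp add: power2_eq_square)
  then show ?thesis by (simp add: R_star_def)
qed

text \<open>
$R_*$ is the smaller root of $1 - 3r + r^2 = (1-r)^2 - r$.
\<close>

lemma less_R_star_imp:
  assumes "r < R_star"
  shows "r < 2 / 5" "r < (1 - r)\<^sup>2"
proof -
  show "r < 2 / 5" using assms R_star_less by simp
  have "sqrt 5 < 3 - 2 * r" using assms by (simp add: R_star_def)
  then have "(sqrt 5)\<^sup>2 < (3 - 2 * r)\<^sup>2" by (intro power_strict_mono) auto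
  then show "r < (1 - r)\<^sup>2" by (simp add: power2_eq_square algebra_simps)
qed

lemma a_eval_pos:
  assumes "\<And>j. c j \<ge> 2" "- R_star < q" "q < 1"
  shows "a_eval c N q > 0"
proof (cases "q \<ge> 0")
  case True
  then show ?thesis using a_eval_ge_1[of c q N] assms by fastforce
next
  case False
  then show ?thesis
    using a_eval_neg_pos[of "- q" c N] less_R_star_imp[of "- q"] assms by auto
qed

text \<open>
The rate $q$ for nonnegative $q$ and the rate $r/(1-r)^2$ at $q = -r$. A maximum of two
continuous functions is used so that continuity at $0$ is immediate.
\<close>

definition term_rate :: "real \<Rightarrow> real" where
  "term_rate q = max q (- q / (1 + q)\<^sup>2)"

lemma term_rate_less_1:
  assumes "- R_star < q" "q < 1"
  shows "term_rate q < 1"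
proof -
  have "- q < (1 + q)\<^sup>2" "0 < 1 + q"
    using less_R_star_imp[of "- q"] assms by auto
  then have "- q / (1 + q)\<^sup>2 < 1" by (subst divide_less_eq_1_pos) simp_all
  then show ?thesis using assms by (simp add: term_rate_def)
qed

lemma term_rate_nonneg: "term_rate q \<ge> 0"
proof (cases "q \<ge> 0")
  case False
  then have "- q / (1 + q)\<^sup>2 \<ge> 0" by (intro divide_nonneg_nonneg) auto
  then show ?thesis unfolding term_rate_def by linarith
qed (simp add: term_rate_def)

text \<open>
The constant 3 absorbs $1/(1-r)^2$, which is below $25/9$ because $r < R_* < 2/5$.
\<close>

lemma real_term_bound:
  assumes c: "\<And>j. c j \<ge> 2" and q: "- R_star < q" "q < 1"
  shows "\<bar>real_term c N q\<bar> \<le> 3 * term_rate q ^ N"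
proof (cases "q \<ge> 0")
  case True
  have "\<bar>real_term c N q\<bar> \<le> q ^ N" using real_term_bound_nonneg[of c q N] c q True by simp
  also have "\<dots> \<le> term_rate q ^ N" using True by (intro power_mono) (auto simp: term_rate_def)
  also have "\<dots> \<le> 3 * term_rate q ^ N" using term_rate_nonneg by simp
  finally show ?thesis .
next
  case False
  have b: "- q < 2 / 5" "- q < (1 + q)\<^sup>2" using less_R_star_imp[of "- q"] q by auto
  have "(3 / 5)\<^sup>2 \<le> (1 + q)\<^sup>2" using b by (intro power_mono) auto
  then have "1 / (1 + q)\<^sup>2 \<le> 1 / (3 / 5)\<^sup>2" by (intro divide_left_mono) (use b in \<open>auto simp: power2_eq_square\<close>)
  then have k: "1 / (1 + q)\<^sup>2 \<le> 3" by (simp add: power2_eq_square)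
  have "\<bar>real_term c N q\<bar> \<le> (- q / (1 + q)\<^sup>2) ^ N * (1 / (1 + q)\<^sup>2)"
    using real_term_bound_neg[of "- q" c N] b c False by simp
  also have "\<dots> \<le> term_rate q ^ N * 3"
    using k term_rate_nonneg[of q] False
    by (intro mult_mono power_mono) (auto simp: term_rate_def)
  finally show ?thesis by (simp add: mult.commute)
qed

lemma summable_abs_real_term:
  assumes "\<And>j. c j \<ge> 2" "- R_star < q" "q < 1"
  shows "summable (\<lambda>N. \<bar>real_term c N q\<bar>)"
proof (rule summable_comparison_test')
  show "summable (\<lambda>N. 3 * term_rate q ^ N)"
    using term_rate_nonneg[of q] term_rate_less_1[of q] assms
    by (intro summable_mult summable_geometric) auto
  show "norm \<bar>real_term c N q\<bar> \<le> 3 * term_rate q ^ N" for N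
    using real_term_bound[of c q N] assms by simp
qed

lemma uniform_limit_real_term:
  assumes c: "\<And>j. c j \<ge> 2" and K: "compact K" "K \<subseteq> {- R_star<..<1}"
  shows "uniform_limit K (\<lambda>n q. \<Sum>N<n. real_term c N q) (\<lambda>q. \<Sum>N. real_term c N q) sequentially"
proof (cases "K = {}")
  case False
  have "continuous_on K term_rate"
    unfolding term_rate_def using K R_star_less by (intro continuous_intros) force
  then obtain p where p: "p \<in> K" "\<And>q. q \<in> K \<Longrightarrow> term_rate q \<le> term_rate p"
    using continuous_attains_sup[OF K(1) False] by blast
  show ?thesis
  proof (rule Weierstrass_m_test)
    show "summable (\<lambda>N. 3 * term_rate p ^ N)"
      using term_rate_nonneg[of p] term_rate_less_1[of p] p K
      by (intro summable_mult summable_geometric) auto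
    show "norm (real_term c N q) \<le> 3 * term_rate p ^ N" if "q \<in> K" for N q
    proof -
      have "\<bar>real_term c N q\<bar> \<le> 3 * term_rate q ^ N"
        using real_term_bound[of c q N] c K that by auto
      also have "\<dots> \<le> 3 * term_rate p ^ N"
        using p that term_rate_nonneg by (intro mult_left_mono power_mono) auto
      finally show ?thesis by simp
    qed
  qed
qed simp

lemma continuous_on_real_series:
  assumes c: "\<And>j. c j \<ge> 2"
  shows "continuous_on {- R_star<..<1} (\<lambda>q. \<Sum>N. real_term c N q)"
proof (rule continuous_at_imp_continuous_on, intro ballI)
  fix q :: real
  assume "q \<in> {- R_star<..<1}"
  then obtain e where e: "e > 0" "cball q e \<subseteq> {- R_star<..<1}"
    using open_contains_cball[of "{- R_star<..<1}"] by (metis open_greaterThanLessThan)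
  have "continuous_on (cball q e) (\<lambda>q. \<Sum>N<n. real_term c N q)" for n
  proof -
    have "a_eval c N z \<noteq> 0" if "z \<in> cball q e" for N z
      using a_eval_pos[of c z N] c that e by fastforce
    then show ?thesis
      unfolding real_term_def by (intro continuous_intros continuous_on_a_eval) auto
  qed
  then have "continuous_on (cball q e) (\<lambda>q. \<Sum>N. real_term c N q)"
    by (intro uniform_limit_theorem[OF _ uniform_limit_real_term[of c]] always_eventually) (use c e in auto)
  then show "isCont (\<lambda>q. \<Sum>N. real_term c N q) q"
    by (rule continuous_on_interior) (use e in auto)
qed

text \<open>
The partial sums are positive, but this only makes the limit nonnegative. That it does not vanish
follows from the front recursion, which in the limit exhibits an inverse of the sum in terms of the
series of the shifted sequence.
\<close>

lemma real_series_pos: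
  assumes c: "\<And>j. c j \<ge> 2" and q: "- R_star < q" "q < 1"
  shows "(\<Sum>N. real_term c N q) > 0"
proof -
  let ?d = "\<lambda>j. c (Suc j)"
  have lim: "(\<lambda>n. \<Sum>N<Suc n. real_term f N q) \<longlonglongrightarrow> (\<Sum>N. real_term f N q)" if "\<And>j. f j \<ge> 2" for f
  proof -
    have "summable (\<lambda>N. \<bar>real_term f N q\<bar>)"
      by (rule summable_abs_real_term) (fact that q)+
    then show ?thesis by (rule LIMSEQ_Suc[OF summable_LIMSEQ[OF summable_rabs_cancel]])
  qed
  have pos: "a_eval f n q > 0" if "\<And>j. f j \<ge> 2" for f n
    using a_eval_pos[of f q n] that q by blast
  have part: "(\<Sum>N<Suc n. real_term f N q) = a_eval (\<lambda>j. f (Suc j)) n q / a_eval f (Suc n) q"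
    if "\<And>j. f j \<ge> 2" for f n
    using pos[of f] that by (intro sum_real_term) (simp add: less_imp_neq[THEN not_sym])
  have "(\<Sum>N<Suc (Suc n). real_term c N q) *
      (q_num (c 0) q - q ^ (c 0 - 1) * (\<Sum>N<Suc n. real_term ?d N q)) = 1" for n
  proof -
    have "a_eval c (Suc (Suc n)) q > 0" "a_eval ?d (Suc n) q > 0"
      using pos[of c] pos[of ?d] c by blast+
    moreover have "q_num (c 0) q - q ^ (c 0 - 1) * (\<Sum>N<Suc n. real_term ?d N q) =
        a_eval c (Suc (Suc n)) q / a_eval ?d (Suc n) q"
      unfolding part[of ?d n, OF c] a_eval_front_recursion[of c n q]
      using \<open>a_eval ?d (Suc n) q > 0\<close> by (simp add: diff_divide_distrib)
    ultimately show ?thesis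
      unfolding part[of c "Suc n", OF c] by simp
  qed
  moreover have "(\<lambda>n. (\<Sum>N<Suc (Suc n). real_term c N q) *
      (q_num (c 0) q - q ^ (c 0 - 1) * (\<Sum>N<Suc n. real_term ?d N q)))
    \<longlonglongrightarrow> (\<Sum>N. real_term c N q) * (q_num (c 0) q - q ^ (c 0 - 1) * (\<Sum>N. real_term ?d N q))"
    by (intro tendsto_intros LIMSEQ_Suc[OF lim[of c]] lim[of ?d] c)
  ultimately have "(\<Sum>N. real_term c N q) * (q_num (c 0) q - q ^ (c 0 - 1) * (\<Sum>N. real_term ?d N q)) = 1"
    by (simp only: LIMSEQ_const_iff)
  then have "(\<Sum>N. real_term c N q) \<noteq> 0" by auto
  moreover have "(\<Sum>N. real_term c N q) \<ge> 0"
  proof (rule LIMSEQ_le_const[OF lim])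
    show "\<exists>M. \<forall>n\<ge>M. 0 \<le> (\<Sum>N<Suc n. real_term c N q)"
      unfolding part[OF c] using pos[of c] pos[of ?d] c by (simp add: less_imp_le)
  qed (rule c)
  ultimately show ?thesis by simp
qed

theorem theorem4p13:
  fixes x :: real
  assumes "x > 1"
  shows
    "fps_term (ncf x) sums fps_recip (q_real x) \<and>
     (\<forall>q\<in>{-R_star<..<1}. \<forall>N. a_eval (ncf x) N q \<noteq> 0) \<and>
     (\<forall>q\<in>{-R_star<..<1}. summable (\<lambda>N. \<bar>real_term (ncf x) N q\<bar>)) \<and>
     (\<forall>K. compact K \<and> K \<subseteq> {-R_star<..<1} \<longrightarrow>
        uniform_limit K (\<lambda>n q. \<Sum>N<n. real_term (ncf x) N q)
          (\<lambda>q. \<Sum>N. real_term (ncf x) N q) sequentially) \<and>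
     continuous_on {-R_star<..<1} (\<lambda>q. \<Sum>N. real_term (ncf x) N q) \<and>
     (\<forall>q\<in>{-R_star<..<1}. (\<Sum>N. real_term (ncf x) N q) > 0)"
proof -
  have x: "x \<ge> 1" using assms by simp
  have c: "\<And>j. ncf x j \<ge> 2"
    using is_ncf_expansion_ncf[OF x] by (auto simp: is_ncf_expansion_def)
  have "a_eval (ncf x) N q \<noteq> 0" if "q \<in> {-R_star<..<1}" for q N
    using a_eval_pos[of "ncf x" q N] c that by force
  then show ?thesis
    using fps_term_sums[OF x] summable_abs_real_term[of "ncf x"] uniform_limit_real_term[of "ncf x"]
      continuous_on_real_series[of "ncf x"] real_series_pos[of "ncf x"] c by auto
qed

end
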